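(* Let $\alpha>0$, $n\in\mathbb N$, and let $p_j(x)=P_j(x^\alpha)$, $j\in\{0,\dots,n-1\}$, where all $P_j$ are polynomials. Then every $\alpha$-analytic solution $y$ of the equation $$\mathbb D_\alpha^{n}y+p_{n-1}(x)\mathbb D_\alpha^{n-1}y+\dots+p_1(x)\mathbb D_\alpha y+p_0(x)y=0$$ has the form $y(t)=v(t^\alpha)$, where $v$ is an entire function of finite order of growth.
   Context: A function $u$ is $\alpha$-analytic (here on $[0,\infty)$) if $u(t)=\sum_{m=0}^\infty u_mt^{\alpha m}$ with the series converging for all $t\ge0$. $\mathbb D_\alpha$ is the Caputo-Djrbashian fractional derivative of order $\alpha$: for $l-1<\alpha\le l$, $l\in\mathbb N$, $$(\mathbb D_\alpha\varphi)(x)=D^\alpha\Big(\varphi(x)-\sum_{k=0}^{l-1}\frac{\varphi^{(k)}(0)}{k!}x^k\Big),$$ where $D^\alpha\varphi=\frac{d^l}{dx^l}I^{l-\alpha}\varphi$ is the Riemann-Liouville derivative, $I^{\beta}\varphi(x)=\frac1{\Gamma(\beta)}\int_0^x(x-t)^{\beta-1}\varphi(t)\,dt$ for $\beta>0$, and $I^0\varphi=\varphi$. $\mathbb D_\alpha^{j}$ denotes the $j$-th iterate of $\mathbb D_\alpha$. On an $\alpha$-analytic function $u(t)=\sum_{m\ge0}u_mt^{\alpha m}$ it acts termwise: $$(\mathbb D_\alpha^{j}u)(t)=\sum_{m=0}^\infty u_{m+j}\frac{\Gamma((m+j)\alpha+1)}{\Gamma(m\alpha+1)}t^{\alpha m}.$$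 The order of a non-constant entire function $v$ is $\sigma(v)=\limsup_{r\to\infty}\frac{\log\log M(r,v)}{\log r}$, where $M(r,v)=\max\{|v(z)|:|z|=r\}$; constants are regarded as having order $0$. *)

theory Defs
  imports "HOL-Complex_Analysis.Complex_Analysis"
begin

text \<open>
  Functions on the half-line \<open>[0,\<infinity>)\<close> are modelled as total functions on the reals whose values
  at negative arguments are irrelevant; complex values and coefficients include the real case.

  The power \<open>t\<^sup>\<alpha>\<^sup>m\<close> is written \<open>(t powr \<alpha>) ^ m\<close> because \<open>0 powr 0 = 0\<close>, which would give the wrong
  value of the constant term at \<open>t = 0\<close>.
\<close>

definition alpha_analytic :: "real \<Rightarrow> (real \<Rightarrow> complex) \<Rightarrow> bool" where
  "alpha_analytic \<alpha> u \<longleftrightarrow>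
     (\<exists>c :: nat \<Rightarrow> complex. \<forall>t\<ge>0. (\<lambda>m. c m * of_real ((t powr \<alpha>) ^ m)) sums u t)"

definition frac_integral :: "real \<Rightarrow> (real \<Rightarrow> complex) \<Rightarrow> real \<Rightarrow> complex" where
  "frac_integral \<beta> \<phi> x =
     (if \<beta> = 0 then \<phi> x
      else (1 / Gamma \<beta>) *\<^sub>R integral {0..x} (\<lambda>t. ((x - t) powr (\<beta> - 1)) *\<^sub>R \<phi> t))"

text \<open>The derivative on \<open>[0,\<infinity>)\<close>: one-sided at \<open>0\<close>, the ordinary one at \<open>x > 0\<close>.\<close>

definition half_line_deriv :: "(real \<Rightarrow> complex) \<Rightarrow> real \<Rightarrow> complex" where
  "half_line_deriv \<phi> x = vector_derivative \<phi> (at x within {0..})"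

text \<open>For \<open>\<alpha> > 0\<close>, \<open>nat \<lceil>\<alpha>\<rceil>\<close> is the unique positive integer \<open>l\<close> with \<open>l - 1 < \<alpha> \<le> l\<close>.\<close>

definition riemann_liouville_deriv :: "real \<Rightarrow> (real \<Rightarrow> complex) \<Rightarrow> real \<Rightarrow> complex" where
  "riemann_liouville_deriv \<alpha> \<phi> =
     (let l = nat \<lceil>\<alpha>\<rceil> in (half_line_deriv ^^ l) (frac_integral (real l - \<alpha>) \<phi>))"

definition caputo_deriv :: "real \<Rightarrow> (real \<Rightarrow> complex) \<Rightarrow> real \<Rightarrow> complex" where
  "caputo_deriv \<alpha> \<phi> =
     (let l = nat \<lceil>\<alpha>\<rceil> in
        riemann_liouville_deriv \<alpha>
          (\<lambda>x. \<phi> x - (\<Sum>k<l. (half_line_deriv ^^ k) \<phi> 0 / fact k * of_real (x ^ k))))"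

definition max_modulus :: "real \<Rightarrow> (complex \<Rightarrow> complex) \<Rightarrow> real" where
  "max_modulus r v = (SUP z\<in>sphere 0 r. cmod (v z))"

definition growth_order :: "(complex \<Rightarrow> complex) \<Rightarrow> ereal" where
  "growth_order v =
     (if v constant_on UNIV then 0
      else Limsup at_top (\<lambda>r::real. ereal (ln (ln (max_modulus r v)) / ln r)))"

end

theory Submission
  imports Defs
begin

text \<open>
  Write \<open>y(t) = f(t\<^sup>\<alpha>)\<close> with coefficients \<open>f\<^sub>m\<close>, and put \<open>g\<^sub>m = \<Gamma>(m\<alpha> + 1)\<close>, \<open>b\<^sub>m = f\<^sub>m g\<^sub>m\<close>. The equation
  expresses \<open>b\<^bsub>m+n\<^esub>\<close> linearly through the terms \<open>b\<^bsub>m-i+j\<^esub> g\<^sub>m / g\<^bsub>m-i\<^esub>\<close>, where \<open>j < n\<close> and \<open>i \<le> d\<close> for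
  a bound \<open>d\<close> on the degrees. The index gap \<open>s = i + n - j\<close> is at least \<open>i + 1\<close>, so log-convexity
  of the Gamma function bounds \<open>g\<^sub>m / g\<^bsub>m-i\<^esub>\<close>, up to geometric factors, by the power \<open>i/s \<le> d/(d+1)\<close> of
  \<open>g\<^bsub>m+n\<^esub> / g\<^bsub>m-i+j\<^esub>\<close>. Inductively \<open>|b\<^sub>m| \<le> K A\<^sup>m g\<^sub>m\<close> with \<open>g\<^sub>m\<close> raised to \<open>d/(d+1)\<close>, and so
  \<open>|f\<^sub>m|\<close> is at most \<open>K A\<^sup>m\<close> times the power \<open>-1/(d+1)\<close> of \<open>g\<^sub>m\<close>, which makes \<open>f\<close> an entire function
  of order at most \<open>(d+1)/\<alpha>\<close>.
\<close>

section \<open>Differentiation of fractional power series\<close>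

text \<open>The case distinction on the exponent is needed because \<open>0 powr 0 = 0\<close>.\<close>

definition frac_power_series :: "real \<Rightarrow> real \<Rightarrow> complex fps \<Rightarrow> real \<Rightarrow> complex" where
  "frac_power_series \<alpha> e f t =
     (if e = 0 then 1 else of_real (t powr e)) * eval_fps f (of_real (t powr \<alpha>))"

text \<open>The operator \<open>e + \<alpha> X d/dX\<close> on coefficients: differentiating a power
  with exponent \<open>\<alpha> * m + e\<close> produces that exponent as a factor.\<close>

definition euler_fps :: "real \<Rightarrow> real \<Rightarrow> complex fps \<Rightarrow> complex fps" where
  "euler_fps \<alpha> e f = Abs_fps (\<lambda>m. of_real (\<alpha> * real m + e) * fps_nth f m)"

lemma fps_conv_radius_infinity_mult:
  fixes f g :: "complex fps"
  assumes "fps_conv_radius f = \<infinity>" "fps_conv_radius g = \<infinity>"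
  shows "fps_conv_radius (f * g) = \<infinity>"
  using fps_conv_radius_mult[of f g] assms by simp

lemma fps_conv_radius_infinity_add:
  fixes f g :: "complex fps"
  assumes "fps_conv_radius f = \<infinity>" "fps_conv_radius g = \<infinity>"
  shows "fps_conv_radius (f + g) = \<infinity>"
  using fps_conv_radius_add[of f g] assms by simp

text \<open>Convergence at one point of each modulus determines the radius, so the positive reals,
  where \<alpha>-analyticity supplies it, suffice.\<close>

lemma fps_conv_radius_infinityI:
  fixes f :: "complex fps"
  assumes "\<And>x::real. x > 0 \<Longrightarrow> summable (\<lambda>m. fps_nth f m * of_real x ^ m)"
  shows "fps_conv_radius f = \<infinity>"
  unfolding fps_conv_radius_def
proof (rule conv_radius_inftyI'[of 0])
  fix r :: real assume "r > 0"
  thus "\<exists>z. norm z = r \<and> summable (\<lambda>n. fps_nth f n * z ^ n)"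
    using assms[of r] by (intro exI[of _ "of_real r"]) simp
qed

lemma euler_fps_eq:
  "euler_fps \<alpha> e f = fps_const (of_real e) * f + fps_const (of_real \<alpha>) * (fps_X * fps_deriv f)"
proof (rule fps_ext)
  fix m
  show "fps_nth (euler_fps \<alpha> e f) m
    = fps_nth (fps_const (of_real e) * f + fps_const (of_real \<alpha>) * (fps_X * fps_deriv f)) m"
    by (cases m) (simp_all add: euler_fps_def algebra_simps)
qed

lemma fps_conv_radius_infinity_deriv:
  fixes f :: "complex fps"
  assumes "fps_conv_radius f = \<infinity>"
  shows "fps_conv_radius (fps_deriv f) = \<infinity>"
  using fps_conv_radius_deriv[of f] assms by simp

lemma fps_conv_radius_euler_fps:
  assumes "fps_conv_radius f = \<infinity>"
  shows "fps_conv_radius (euler_fps \<alpha> e f) = \<infinity>"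
  unfolding euler_fps_eq
  by (intro fps_conv_radius_infinity_add fps_conv_radius_infinity_mult
        fps_conv_radius_infinity_deriv assms) simp_all

lemma eval_euler_fps:
  assumes "fps_conv_radius f = \<infinity>"
  shows "eval_fps (euler_fps \<alpha> e f) z =
    of_real e * eval_fps f z + of_real \<alpha> * z * eval_fps (fps_deriv f) z"
  using assms fps_conv_radius_infinity_deriv[OF assms] unfolding euler_fps_eq
  by (simp add: eval_fps_add eval_fps_mult fps_conv_radius_infinity_mult)

lemma has_vector_derivative_eval_fps_powr:
  fixes f :: "complex fps"
  assumes f: "fps_conv_radius f = \<infinity>" and t: "t > 0"
  shows "((\<lambda>t. eval_fps f (of_real (t powr \<alpha>))) has_vector_derivative
           of_real (\<alpha> * t powr (\<alpha> - 1)) * eval_fps (fps_deriv f) (of_real (t powr \<alpha>))) (at t within S)"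
proof -
  have "((\<lambda>t. t powr \<alpha>) has_field_derivative \<alpha> * t powr (\<alpha> - 1)) (at t within S)"
    using has_real_derivative_powr[OF t, of \<alpha>] by (rule has_field_derivative_at_within)
  hence 1: "((\<lambda>t. complex_of_real (t powr \<alpha>)) has_vector_derivative
      of_real (\<alpha> * t powr (\<alpha> - 1))) (at t within S)"
    by (rule has_vector_derivative_of_real)
  show ?thesis
    using field_vector_diff_chain_within[OF 1 has_field_derivative_eval_fps] f
    by (simp add: o_def)
qed

lemma has_vector_derivative_frac_power_series_pos:
  assumes f: "fps_conv_radius f = \<infinity>" and t: "t > 0"
  shows "(frac_power_series \<alpha> e f has_vector_derivative
           frac_power_series \<alpha> (e - 1) (euler_fps \<alpha> e f) t) (at t within S)"
proof -
  have "((\<lambda>t. t powr e) has_field_derivative e * t powr (e - 1)) (at t within S)"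
    using has_real_derivative_powr[OF t, of e] by (rule has_field_derivative_at_within)
  hence 1: "((\<lambda>t. complex_of_real (t powr e)) has_vector_derivative
      of_real (e * t powr (e - 1))) (at t within S)"
    by (rule has_vector_derivative_of_real)
  have 2: "((\<lambda>t. complex_of_real (t powr e) * eval_fps f (of_real (t powr \<alpha>))) has_vector_derivative
      of_real (t powr e) * (of_real (\<alpha> * t powr (\<alpha> - 1)) * eval_fps (fps_deriv f) (of_real (t powr \<alpha>)))
      + of_real (e * t powr (e - 1)) * eval_fps f (of_real (t powr \<alpha>))) (at t within S)"
    by (rule has_vector_derivative_mult[OF 1 has_vector_derivative_eval_fps_powr[OF f t]])
  \<comment> \<open>Moving one power of \<open>t\<close> from the prefactor to the inner derivative
    gives both summands of the product rule the common factor \<open>t powr (e - 1)\<close>.\<close>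
  have 3: "t powr e * (\<alpha> * t powr (\<alpha> - 1)) = t powr (e - 1) * (\<alpha> * t powr \<alpha>)"
    using t by (simp add: powr_diff)
  have "of_real (t powr e) * (of_real (\<alpha> * t powr (\<alpha> - 1)) * eval_fps (fps_deriv f) (of_real (t powr \<alpha>)))
     = of_real (t powr (e - 1) * (\<alpha> * t powr \<alpha>)) * eval_fps (fps_deriv f) (of_real (t powr \<alpha>))"
    by (simp only: 3[symmetric] of_real_mult mult.assoc)
  hence 4: "of_real (t powr e) * (of_real (\<alpha> * t powr (\<alpha> - 1)) * eval_fps (fps_deriv f) (of_real (t powr \<alpha>)))
      + of_real (e * t powr (e - 1)) * eval_fps f (of_real (t powr \<alpha>))
     = frac_power_series \<alpha> (e - 1) (euler_fps \<alpha> e f) t"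
    using t by (auto simp: frac_power_series_def eval_euler_fps[OF f] algebra_simps)
  have "frac_power_series \<alpha> e f s = of_real (s powr e) * eval_fps f (of_real (s powr \<alpha>))"
    if "s > 0" for s using that by (simp add: frac_power_series_def)
  with 2 4 t show ?thesis
    by (subst has_vector_derivative_cong_ev[where g =
          "\<lambda>t. complex_of_real (t powr e) * eval_fps f (of_real (t powr \<alpha>))"])
       (auto intro!: eventually_mono[OF eventually_nhds_in_open[of "{0<..}"]])
qed

lemma continuous_on_frac_power_series:
  assumes f: "fps_conv_radius f = \<infinity>" and "\<alpha> > 0" "e \<ge> 0"
  shows "continuous_on {0..} (frac_power_series \<alpha> e f)"
proof -
  have 1: "continuous_on {0..} (\<lambda>t::real. t powr c)" if "c > 0" for c
    using that by (intro continuous_on_powr' continuous_intros) auto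
  have 2: "continuous_on {0..} (\<lambda>t. eval_fps f (of_real (t powr \<alpha>)))"
    using f by (auto intro!: continuous_intros 1 assms)
  show ?thesis
  proof (cases "e = 0")
    case True
    thus ?thesis using 2 by (simp add: frac_power_series_def[abs_def])
  next
    case False
    hence "continuous_on {0..} (\<lambda>t. of_real (t powr e) * eval_fps f (of_real (t powr \<alpha>)))"
      using assms by (intro continuous_on_mult 2 continuous_on_of_real 1) auto
    thus ?thesis using False by (simp add: frac_power_series_def[abs_def])
  qed
qed

text \<open>At 0 the difference quotient is \<open>h t\<close> itself, so continuity of
  \<open>h\<close> is enough. This covers the endpoint, where \<open>t powr \<alpha>\<close> need
  not be differentiable and the chain rule fails.\<close>

lemma has_vector_derivative_scaleR_at_0:
  fixes h :: "real \<Rightarrow> 'a::real_normed_vector"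
  assumes "continuous (at 0 within S) h"
  shows "((\<lambda>t. t *\<^sub>R h t) has_vector_derivative h 0) (at 0 within S)"
proof -
  have "((\<lambda>t. norm (h t - h 0)) \<longlongrightarrow> 0) (at 0 within S)"
    using assms by (simp add: continuous_within tendsto_norm_zero LIM_zero)
  moreover have "\<forall>\<^sub>F t in at 0 within S. norm (h t - h 0) = norm (t *\<^sub>R h t - t *\<^sub>R h 0) / norm t"
    by (auto simp: eventually_at_filter scaleR_diff_right[symmetric])
  ultimately have "((\<lambda>t. norm (t *\<^sub>R h t - t *\<^sub>R h 0) / norm t) \<longlongrightarrow> 0) (at 0 within S)"
    by (simp add: tendsto_cong)
  thus ?thesis
    by (simp add: has_vector_derivative_def has_derivative_iff_norm bounded_linear_scaleR_left)
qed

text \<open>For \<open>t > 0\<close> this is the product rule. At the endpoint a factor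
  \<open>t\<close> is split off, and the remaining series with exponent \<open>e - 1 \<ge> 0\<close>
  is continuous there.\<close>

lemma has_vector_derivative_frac_power_series:
  assumes f: "fps_conv_radius f = \<infinity>" and "\<alpha> > 0" "e \<ge> 1" "t \<ge> 0"
  shows "(frac_power_series \<alpha> e f has_vector_derivative
           frac_power_series \<alpha> (e - 1) (euler_fps \<alpha> e f) t) (at t within {0..})"
proof (cases "t = 0")
  case False
  thus ?thesis using has_vector_derivative_frac_power_series_pos[OF f] assms by simp
next
  case True
  have "continuous (at 0 within {0..}) (frac_power_series \<alpha> (e - 1) f)"
    using continuous_on_frac_power_series[OF f, of \<alpha> "e - 1"] assms
    by (auto simp: continuous_on_eq_continuous_within)
  hence "((\<lambda>t. t *\<^sub>R frac_power_series \<alpha> (e - 1) f t) has_vector_derivative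
      frac_power_series \<alpha> (e - 1) f 0) (at 0 within {0..})"
    by (rule has_vector_derivative_scaleR_at_0)
  \<comment> \<open>For \<open>e > 1\<close> both sides vanish; for \<open>e = 1\<close> they are
    the constant coefficient, which the Euler factor multiplies by \<open>e = 1\<close>.\<close>
  moreover have "frac_power_series \<alpha> (e - 1) f 0 = frac_power_series \<alpha> (e - 1) (euler_fps \<alpha> e f) 0"
    by (simp add: frac_power_series_def eval_fps_at_0 euler_fps_def)
  moreover have "frac_power_series \<alpha> e f s = s *\<^sub>R frac_power_series \<alpha> (e - 1) f s" if "s \<ge> 0" for s
    using that assms
    by (cases "s = 0") (auto simp: frac_power_series_def powr_diff scaleR_conv_of_real)
  ultimately show ?thesis using True
    by (auto intro: has_vector_derivative_transform)
qed

lemma half_line_deriv_eqI: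
  assumes "(f has_vector_derivative f') (at x within {0..})" "x \<ge> 0"
  shows "half_line_deriv f x = f'"
proof -
  have "at x within {0..} \<noteq> bot"
  proof (cases "x = 0")
    case True
    thus ?thesis by (simp add: at_within_Ici_at_right)
  next
    case False
    hence "at x within {0..} = at x" using assms by (intro at_within_interior) auto
    thus ?thesis by simp
  qed
  thus ?thesis using assms unfolding half_line_deriv_def
    by (intro vector_derivative_within)
qed

lemma half_line_deriv_frac_power_series:
  assumes "fps_conv_radius f = \<infinity>" "\<alpha> > 0" "e \<ge> 1" "t \<ge> 0"
    and "\<And>t. t \<ge> 0 \<Longrightarrow> F t = c + frac_power_series \<alpha> e f t"
  shows "half_line_deriv F t = frac_power_series \<alpha> (e - 1) (euler_fps \<alpha> e f) t"
proof (rule half_line_deriv_eqI)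
  have "((\<lambda>t. c + frac_power_series \<alpha> e f t) has_vector_derivative
      0 + frac_power_series \<alpha> (e - 1) (euler_fps \<alpha> e f) t) (at t within {0..})"
    by (intro has_vector_derivative_add has_vector_derivative_frac_power_series assms) simp
  thus "(F has_vector_derivative frac_power_series \<alpha> (e - 1) (euler_fps \<alpha> e f) t) (at t within {0..})"
    using assms by (intro has_vector_derivative_transform[where g = F]) auto
qed fact

text \<open>Each derivative lowers the exponent by one, and \<open>real k \<le> e\<close> keeps it
  at least 1 before every step, so differentiation at 0 remains legitimate. The first derivative
  removes the constant \<open>c\<close>, which is why \<open>k \<ge> 1\<close>.\<close>

lemma half_line_deriv_funpow_frac_power_series:
  assumes "fps_conv_radius f = \<infinity>" "\<alpha> > 0" "real k \<le> e" "t \<ge> 0" "k \<ge> 1"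
    and "\<And>t. t \<ge> 0 \<Longrightarrow> F t = c + frac_power_series \<alpha> e f t"
  defines "g \<equiv> Abs_fps (\<lambda>m. of_real (\<Prod>i<k. \<alpha> * real m + e - real i) * fps_nth f m)"
  shows "fps_conv_radius g = \<infinity>"
    and "(half_line_deriv ^^ k) F t = frac_power_series \<alpha> (e - real k) g t"
proof -
  let ?g = "\<lambda>k. Abs_fps (\<lambda>m. of_real (\<Prod>i<k. \<alpha> * real m + e - real i) * fps_nth f m)"
  have step: "euler_fps \<alpha> (e - real j) (?g j) = ?g (Suc j)" for j
    by (rule fps_ext) (simp add: euler_fps_def algebra_simps)
  have conv: "fps_conv_radius (?g j) = \<infinity>" for j
  proof (induction j)
    case 0
    thus ?case using assms by (simp add: fps_nth_inverse)
  next
    case (Suc j)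
    show ?case unfolding step[symmetric] by (rule fps_conv_radius_euler_fps[OF Suc])
  qed
  have "real k \<le> e \<Longrightarrow> \<forall>t\<ge>0. (half_line_deriv ^^ k) F t = frac_power_series \<alpha> (e - real k) (?g k) t"
    using \<open>k \<ge> 1\<close>
  proof (induction k rule: dec_induct)
    case base
    have "half_line_deriv F t = frac_power_series \<alpha> (e - 1) (euler_fps \<alpha> e f) t" if "t \<ge> 0" for t
      using that assms base by (intro half_line_deriv_frac_power_series[where c = c]) auto
    moreover have "euler_fps \<alpha> e f = ?g 1"
      by (rule fps_ext) (simp add: euler_fps_def)
    ultimately show ?case by simp
  next
    case (step k)
    have "half_line_deriv ((half_line_deriv ^^ k) F) t
       = frac_power_series \<alpha> (e - real k - 1) (euler_fps \<alpha> (e - real k) (?g k)) t" if "t \<ge> 0" for t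
      using that assms step
      by (intro half_line_deriv_frac_power_series[where c = 0] conv) auto
    thus ?case unfolding \<open>\<And>j. euler_fps \<alpha> (e - real j) (?g j) = ?g (Suc j)\<close>
      by (simp add: algebra_simps)
  qed
  thus "(half_line_deriv ^^ k) F t = frac_power_series \<alpha> (e - real k) g t"
    using assms by simp
  show "fps_conv_radius g = \<infinity>" using conv unfolding g_def .
qed

section \<open>Fractional integrals and the Caputo derivative\<close>

text \<open>The substitution \<open>t = x * s\<close> reduces this to the Beta integral over the
  unit interval.\<close>

lemma has_integral_Beta_scaled:
  fixes a \<beta> x :: real
  assumes "a > -1" "\<beta> > 0" "x > 0"
  shows "((\<lambda>t. (x - t) powr (\<beta> - 1) * t powr a) has_integral x powr (a + \<beta>) * Beta (a + 1) \<beta>) {0..x}"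
proof -
  have img: "(\<lambda>t. t / (1 / x)) ` {0..1} = {0..x}"
    using assms image_mult_atLeastAtMost[of x 0 1] by (simp add: mult.commute)
  have "((\<lambda>t. t powr a * (1 - t) powr (\<beta> - 1)) has_integral Beta (a + 1) \<beta>) {0..1}"
    using has_integral_Beta_real[of "a + 1" \<beta>] assms by simp
  from has_integral_stretch_real[OF this, of "1 / x"]
  have "((\<lambda>t. (1 / x * t) powr a * (1 - 1 / x * t) powr (\<beta> - 1)) has_integral x * Beta (a + 1) \<beta>) {0..x}"
    using assms by (simp only: img) simp
  from has_integral_mult_right[OF this, of "x powr (a + \<beta> - 1)"]
  have "((\<lambda>t. x powr (a + \<beta> - 1) * ((1 / x * t) powr a * (1 - 1 / x * t) powr (\<beta> - 1)))
      has_integral x powr (a + \<beta> - 1) * (x * Beta (a + 1) \<beta>)) {0..x}" .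
  moreover have "x powr (a + \<beta> - 1) * (x * Beta (a + 1) \<beta>) = x powr (a + \<beta>) * Beta (a + 1) \<beta>"
    using assms by (simp add: powr_diff)
  moreover have "x powr (a + \<beta> - 1) * ((1 / x * t) powr a * (1 - 1 / x * t) powr (\<beta> - 1))
      = (x - t) powr (\<beta> - 1) * t powr a" if "t \<in> {0..x}" for t
  proof -
    have "1 - 1 / x * t = (x - t) / x" using assms by (simp add: field_simps)
    hence "(1 - 1 / x * t) powr (\<beta> - 1) = (x - t) powr (\<beta> - 1) / x powr (\<beta> - 1)"
      using that assms by (simp add: powr_divide)
    moreover have "(1 / x * t) powr a = t powr a / x powr a"
      using that assms by (simp add: powr_divide)
    moreover have "x powr (a + \<beta> - 1) = x powr a * x powr (\<beta> - 1)"
      by (simp flip: powr_add add: algebra_simps)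
    ultimately show ?thesis using assms by simp
  qed
  ultimately show ?thesis by (metis (no_types, lifting) has_integral_eq)
qed

text \<open>Integration is termwise: every power becomes a Beta integral, whose quotient by
  \<open>Gamma \<beta>\<close> is the Gamma quotient in \<open>g\<close>. Dominated convergence
  permits the interchange, and convergence of the integrated series at every \<open>x > 0\<close>
  also gives the radius of \<open>g\<close>.\<close>

lemma frac_integral_frac_power_series:
  fixes f :: "complex fps"
  assumes f: "fps_conv_radius f = \<infinity>" and "\<alpha> > 0" "a > 0" "\<beta> \<ge> 0"
    and F: "\<And>t. t \<ge> 0 \<Longrightarrow> F t = frac_power_series \<alpha> a f t"
  defines "g \<equiv> Abs_fps (\<lambda>m. fps_nth f m *
             of_real (Gamma (\<alpha> * real m + a + 1) / Gamma (\<alpha> * real m + a + \<beta> + 1)))"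
  shows "fps_conv_radius g = \<infinity>"
    and "x \<ge> 0 \<Longrightarrow> frac_integral \<beta> F x = frac_power_series \<alpha> (a + \<beta>) g x"
proof -
  have "fps_conv_radius g = \<infinity> \<and> (\<forall>x\<ge>0. frac_integral \<beta> F x = frac_power_series \<alpha> (a + \<beta>) g x)"
  proof (cases "\<beta> = 0")
    case True
    have "Gamma (\<alpha> * real m + a + 1) \<noteq> 0" for m
      using assms by (intro Gamma_real_pos[THEN less_imp_neq, symmetric] add_nonneg_pos add_nonneg_nonneg) auto
    hence "g = f" using True by (intro fps_ext) (simp add: g_def)
    thus ?thesis using True f F by (simp add: frac_integral_def)
  next
    case False
    hence \<beta>: "\<beta> > 0" using assms by simp
    have sums: "(\<lambda>m. fps_nth g m * of_real (x powr \<alpha>) ^ m) sums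
        (frac_integral \<beta> F x / of_real (x powr (a + \<beta>)))" if x: "x > 0" for x
    proof -
      define c where "c m = fps_nth f m" for m
      define k where "k t = (x - t) powr (\<beta> - 1) * t powr a" for t
      define B where "B m = x powr (\<alpha> * real m + a + \<beta>) * Beta (\<alpha> * real m + a + 1) \<beta>" for m
      \<comment> \<open>The absolute sum at the right endpoint controls all partial sums on
        \<open>{0..x}\<close>, because \<open>t powr \<alpha> \<le> x powr \<alpha>\<close> there;
        \<open>k t * C\<close> is the integrable majorant.\<close>
      define C where "C = (\<Sum>m. norm (c m * of_real (x powr \<alpha>) ^ m))"
      have C: "summable (\<lambda>m. norm (c m * of_real (x powr \<alpha>) ^ m))"
        unfolding c_def using f by (intro norm_summable_fps) auto
      have hi: "((\<lambda>t. \<Sum>m<n. of_real (k t * (t powr \<alpha>) ^ m) * c m) has_integral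
          (\<Sum>m<n. of_real (B m) * c m)) {0..x}" for n
      proof (intro has_integral_sum has_integral_mult_left)
        fix m
        have "((\<lambda>t. (x - t) powr (\<beta> - 1) * t powr (\<alpha> * real m + a)) has_integral B m) {0..x}"
          unfolding B_def
        proof (rule has_integral_Beta_scaled)
          have "\<alpha> * real m \<ge> 0" using assms by simp
          thus "\<alpha> * real m + a > -1" using assms by linarith
        qed (use \<beta> x in auto)
        moreover have "(x - t) powr (\<beta> - 1) * t powr (\<alpha> * real m + a) = k t * (t powr \<alpha>) ^ m"
          if "t \<in> {0..x}" for t
          using that \<open>\<alpha> > 0\<close> \<open>a > 0\<close>
          by (cases "t = 0") (auto simp: k_def powr_add powr_power mult_ac powr_realpow[symmetric] powr_powr)
        ultimately have "((\<lambda>t. k t * (t powr \<alpha>) ^ m) has_integral B m) {0..x}"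
          by (metis (no_types, lifting) has_integral_eq)
        thus "((\<lambda>t. complex_of_real (k t * (t powr \<alpha>) ^ m)) has_integral of_real (B m)) {0..x}"
          by (rule has_integral_of_real)
      qed simp
      have k0: "k t \<ge> 0" for t by (simp add: k_def)
      have hk: "(\<lambda>t. k t * C) integrable_on {0..x}"
        using has_integral_mult_left[OF has_integral_Beta_scaled[of a \<beta> x], of C] assms \<beta> x
        unfolding k_def by (auto simp: integrable_on_def)
      have bd: "norm (\<Sum>m<n. of_real (k t * (t powr \<alpha>) ^ m) * c m) \<le> k t * C" if "t \<in> {0..x}" for n t
      proof -
        have "norm (\<Sum>m<n. of_real (k t * (t powr \<alpha>) ^ m) * c m)
            \<le> (\<Sum>m<n. norm (of_real (k t * (t powr \<alpha>) ^ m) * c m))"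
          by (rule norm_sum)
        also have "\<dots> \<le> (\<Sum>m<n. k t * norm (c m * of_real (x powr \<alpha>) ^ m))"
        proof (rule sum_mono)
          fix m
          have "(t powr \<alpha>) ^ m \<le> (x powr \<alpha>) ^ m"
            using that assms by (intro power_mono powr_mono2) auto
          thus "norm (of_real (k t * (t powr \<alpha>) ^ m) * c m) \<le> k t * norm (c m * of_real (x powr \<alpha>) ^ m)"
            using k0[of t] by (auto simp: norm_mult norm_power mult_left_mono mult_ac)
        qed
        also have "\<dots> = k t * (\<Sum>m<n. norm (c m * of_real (x powr \<alpha>) ^ m))"
          by (simp add: sum_distrib_left)
        also have "\<dots> \<le> k t * C"
          unfolding C_def by (intro mult_left_mono sum_le_suminf C k0) auto
        finally show ?thesis .
      qed
      have lim: "(\<lambda>n. \<Sum>m<n. of_real (k t * (t powr \<alpha>) ^ m) * c m) \<longlonglongrightarrow> (x - t) powr (\<beta> - 1) *\<^sub>R F t"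
        if "t \<in> {0..x}" for t
      proof -
        have "(\<lambda>m. c m * of_real (t powr \<alpha>) ^ m) sums eval_fps f (of_real (t powr \<alpha>))"
          unfolding c_def using f by (intro sums_eval_fps) auto
        hence "(\<lambda>m. of_real (k t) * (c m * of_real (t powr \<alpha>) ^ m)) sums
            (of_real (k t) * eval_fps f (of_real (t powr \<alpha>)))"
          by (rule sums_mult)
        moreover have "of_real (k t) * eval_fps f (of_real (t powr \<alpha>)) = (x - t) powr (\<beta> - 1) *\<^sub>R F t"
          using that F[of t] \<open>a > 0\<close> by (simp add: frac_power_series_def k_def scaleR_conv_of_real)
        ultimately show ?thesis by (simp add: sums_def mult_ac)
      qed
      have int: "(\<lambda>n. integral {0..x} (\<lambda>t. \<Sum>m<n. of_real (k t * (t powr \<alpha>) ^ m) * c m))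
          \<longlonglongrightarrow> integral {0..x} (\<lambda>t. (x - t) powr (\<beta> - 1) *\<^sub>R F t)"
        using hi by (intro dominated_convergence(2)[OF _ hk bd lim]) (auto simp: integrable_on_def)
      hence "(\<lambda>m. of_real (B m) * c m) sums integral {0..x} (\<lambda>t. (x - t) powr (\<beta> - 1) *\<^sub>R F t)"
        unfolding sums_def integral_unique[OF hi] .
      hence "(\<lambda>m. of_real (1 / (Gamma \<beta> * x powr (a + \<beta>))) * (of_real (B m) * c m)) sums
          (of_real (1 / (Gamma \<beta> * x powr (a + \<beta>))) * integral {0..x} (\<lambda>t. (x - t) powr (\<beta> - 1) *\<^sub>R F t))"
        by (rule sums_mult)
      moreover have "of_real (1 / (Gamma \<beta> * x powr (a + \<beta>))) * integral {0..x} (\<lambda>t. (x - t) powr (\<beta> - 1) *\<^sub>R F t)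
          = frac_integral \<beta> F x / of_real (x powr (a + \<beta>))"
        using False by (simp add: frac_integral_def scaleR_conv_of_real)
      moreover have "of_real (1 / (Gamma \<beta> * x powr (a + \<beta>))) * (of_real (B m) * c m)
          = fps_nth g m * of_real (x powr \<alpha>) ^ m" for m
      proof -
        have e: "x powr (\<alpha> * real m + a + \<beta>) = (x powr \<alpha>) ^ m * x powr (a + \<beta>)"
          using x by (simp add: powr_add powr_powr powr_realpow[symmetric])
        have "Gamma \<beta> \<noteq> 0" using Gamma_real_pos[OF \<beta>] by simp
        hence "1 / (Gamma \<beta> * x powr (a + \<beta>)) * B m =
            (x powr \<alpha>) ^ m * (Gamma (\<alpha> * real m + a + 1) / Gamma (\<alpha> * real m + a + \<beta> + 1))"
          using x unfolding B_def e Beta_def by (simp add: add_ac)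
        hence "of_real (1 / (Gamma \<beta> * x powr (a + \<beta>))) * of_real (B m) = complex_of_real 
            ((x powr \<alpha>) ^ m * (Gamma (\<alpha> * real m + a + 1) / Gamma (\<alpha> * real m + a + \<beta> + 1)))"
          by (metis of_real_mult)
        from arg_cong[OF this, of "\<lambda>z. c m * z"] show ?thesis
          by (simp add: g_def c_def mult_ac)
      qed
      ultimately show ?thesis by simp
    qed
    have conv: "fps_conv_radius g = \<infinity>"
    proof (rule fps_conv_radius_infinityI)
      fix x :: real assume "x > 0"
      thus "summable (\<lambda>m. fps_nth g m * of_real x ^ m)"
        using sums[of "x powr (1 / \<alpha>)"] \<open>\<alpha> > 0\<close> by (simp add: powr_powr sums_iff)
    qed
    moreover have "frac_integral \<beta> F x = frac_power_series \<alpha> (a + \<beta>) g x" if "x \<ge> 0" for x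
    proof (cases "x = 0")
      case True
      thus ?thesis using False assms by (simp add: frac_integral_def frac_power_series_def)
    next
      case False
      hence x: "x > 0" using that by simp
      have "(\<lambda>m. fps_nth g m * of_real (x powr \<alpha>) ^ m) sums eval_fps g (of_real (x powr \<alpha>))"
        using conv by (intro sums_eval_fps) auto
      from sums_unique2[OF this sums[OF x]] show ?thesis
        using x assms by (simp add: frac_power_series_def)
    qed
    ultimately show ?thesis by blast
  qed
  thus "fps_conv_radius g = \<infinity>"
    and "x \<ge> 0 \<Longrightarrow> frac_integral \<beta> F x = frac_power_series \<alpha> (a + \<beta>) g x" by auto
qed

definition caputo_fps :: "real \<Rightarrow> complex fps \<Rightarrow> complex fps" where
  "caputo_fps \<alpha> f = Abs_fps (\<lambda>m. fps_nth f (Suc m) *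
     of_real (Gamma (\<alpha> * real (Suc m) + 1) / Gamma (\<alpha> * real m + 1)))"

lemma eval_fps_shift_1:
  fixes f :: "complex fps"
  assumes "fps_conv_radius f = \<infinity>"
  shows "eval_fps f z = fps_nth f 0 + z * eval_fps (fps_shift 1 f) z"
proof -
  have "f = fps_const (fps_nth f 0) + fps_X * fps_shift 1 f"
    by (rule fps_ext) simp
  hence "eval_fps f z = eval_fps (fps_const (fps_nth f 0) + fps_X * fps_shift 1 f) z"
    by simp
  thus ?thesis using assms
    by (simp add: eval_fps_add eval_fps_mult fps_conv_radius_infinity_mult)
qed

text \<open>Iterated functional equation of Gamma, with the factors in the descending order in which
  \<open>l\<close> ordinary derivatives produce them.\<close>

lemma prod_descending_Gamma:
  fixes x :: real
  assumes "x > 0"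
  shows "(\<Prod>i<l. x + real l - 1 - real i) * Gamma x = Gamma (x + real l)"
  using assms
proof (induction l)
  case (Suc l)
  have "(\<Prod>i<Suc l. x + real (Suc l) - 1 - real i) = (x + real l) * (\<Prod>i<l. x + real l - 1 - real i)"
    by (subst prod.lessThan_Suc_shift) (simp add: algebra_simps)
  moreover have "Gamma (x + real (Suc l)) = (x + real l) * Gamma (x + real l)"
    using Gamma_plus1[of "x + real l"] Suc.prems by (force simp: add_ac elim!: nonpos_Ints_cases')
  ultimately show ?case using Suc by simp
qed simp

text \<open>The subtracted Taylor polynomial is only the constant term, leaving
  \<open>t powr \<alpha>\<close> times the shifted series. Integration of order
  \<open>l - \<alpha>\<close> raises the prefactor exponent to exactly \<open>l\<close>, and
  \<open>l\<close> derivatives bring it down to 0. The accumulated factors collapse to those of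
  \<open>caputo_fps\<close>.\<close>

lemma caputo_deriv_eval_fps:
  fixes f :: "complex fps"
  assumes f: "fps_conv_radius f = \<infinity>" and "\<alpha> > 0"
    and F: "\<And>t. t \<ge> 0 \<Longrightarrow> F t = eval_fps f (of_real (t powr \<alpha>))"
  shows "fps_conv_radius (caputo_fps \<alpha> f) = \<infinity>"
    and "t \<ge> 0 \<Longrightarrow> caputo_deriv \<alpha> F t = eval_fps (caputo_fps \<alpha> f) (of_real (t powr \<alpha>))"
proof -
  define l where "l = nat \<lceil>\<alpha>\<rceil>"
  have l: "l \<ge> 1" "real l - 1 < \<alpha>" "\<alpha> \<le> real l"
    using \<open>\<alpha> > 0\<close> unfolding l_def by linarith+
  define f1 where "f1 = fps_shift 1 f"
  have f1: "fps_conv_radius f1 = \<infinity>" using f by (simp add: f1_def)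
  have F': "F t = fps_nth f 0 + frac_power_series \<alpha> \<alpha> f1 t" if "t \<ge> 0" for t
    using that \<open>\<alpha> > 0\<close> F[of t] eval_fps_shift_1[OF f] by (simp add: frac_power_series_def f1_def)
  have der0: "(half_line_deriv ^^ k) F 0 = 0" if "k \<ge> 1" "k < l" for k
  proof -
    \<comment> \<open>\<open>k \<le> l - 1 < \<alpha>\<close> leaves a positive exponent after
      \<open>k\<close> derivatives, so the value at 0 vanishes.\<close>
    have "real k < \<alpha>" using that l by linarith
    thus ?thesis
      using half_line_deriv_funpow_frac_power_series(2)[OF f1 \<open>\<alpha> > 0\<close> _ _ _ F', of k 0] that
      by (simp add: frac_power_series_def)
  qed
  have sum: "(\<Sum>k<l. (half_line_deriv ^^ k) F 0 / fact k * of_real (x ^ k)) = F 0" for x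
  proof -
    have "(\<Sum>k<l. (half_line_deriv ^^ k) F 0 / fact k * of_real (x ^ k))
        = (\<Sum>k<l. if k = 0 then F 0 else 0)"
      using der0 by (intro sum.cong) auto
    also have "\<dots> = F 0" using l by simp
    finally show ?thesis .
  qed
  have "F 0 = fps_nth f 0" using F'[of 0] \<open>\<alpha> > 0\<close> by (simp add: frac_power_series_def)
  define G where "G x = F x - (\<Sum>k<l. (half_line_deriv ^^ k) F 0 / fact k * of_real (x ^ k))" for x
  have G: "G t = frac_power_series \<alpha> \<alpha> f1 t" if "t \<ge> 0" for t
    using F'[OF that] sum \<open>F 0 = fps_nth f 0\<close> by (simp add: G_def)
  have cap: "caputo_deriv \<alpha> F = (half_line_deriv ^^ l) (frac_integral (real l - \<alpha>) G)"
    by (simp add: caputo_deriv_def riemann_liouville_deriv_def Let_def l_def[symmetric] G_def[abs_def])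
  define g where "g = Abs_fps (\<lambda>m. fps_nth f1 m *
     of_real (Gamma (\<alpha> * real m + \<alpha> + 1) / Gamma (\<alpha> * real m + \<alpha> + (real l - \<alpha>) + 1)))"
  have g: "fps_conv_radius g = \<infinity>"
    and g': "frac_integral (real l - \<alpha>) G t = frac_power_series \<alpha> (real l) g t" if "t \<ge> 0" for t
    using frac_integral_frac_power_series[OF f1 \<open>\<alpha> > 0\<close> \<open>\<alpha> > 0\<close>, of "real l - \<alpha>" G] G l that
    unfolding g_def by auto
  have g0: "fps_conv_radius g = \<infinity>" using g[of 0] by simp
  have h: "Abs_fps (\<lambda>m. of_real (\<Prod>i<l. \<alpha> * real m + real l - real i) * fps_nth g m) = caputo_fps \<alpha> f"
  proof (rule fps_ext)
    fix m
    have p: "\<alpha> * real m + 1 > 0" using \<open>\<alpha> > 0\<close> by (intro add_nonneg_pos) auto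
    have "(\<Prod>i<l. \<alpha> * real m + real l - real i) * Gamma (\<alpha> * real m + 1) = Gamma (\<alpha> * real m + real l + 1)"
      using prod_descending_Gamma[OF p, of l] by (simp add: algebra_simps)
    moreover have "Gamma (\<alpha> * real m + 1) > 0" using p by (rule Gamma_real_pos)
    moreover have "Gamma (\<alpha> * real m + real l + 1) > 0" using p by (intro Gamma_real_pos) simp
    ultimately have "(\<Prod>i<l. \<alpha> * real m + real l - real i) *
        (Gamma (\<alpha> * real m + \<alpha> + 1) / Gamma (\<alpha> * real m + \<alpha> + (real l - \<alpha>) + 1))
        = Gamma (\<alpha> * real (Suc m) + 1) / Gamma (\<alpha> * real m + 1)"
      by (simp add: field_simps)
    hence "complex_of_real (\<Prod>i<l. \<alpha> * real m + real l - real i) *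
        of_real (Gamma (\<alpha> * real m + \<alpha> + 1) / Gamma (\<alpha> * real m + \<alpha> + (real l - \<alpha>) + 1))
        = of_real (Gamma (\<alpha> * real (Suc m) + 1) / Gamma (\<alpha> * real m + 1))"
      by (metis of_real_mult)
    from arg_cong[OF this, of "\<lambda>z. fps_nth f (Suc m) * z"]
    show "fps_nth (Abs_fps (\<lambda>m. of_real (\<Prod>i<l. \<alpha> * real m + real l - real i) * fps_nth g m)) m
        = fps_nth (caputo_fps \<alpha> f) m"
      unfolding caputo_fps_def g_def f1_def by (simp add: mult_ac)
  qed
  show "caputo_deriv \<alpha> F t = eval_fps (caputo_fps \<alpha> f) (of_real (t powr \<alpha>))" if "t \<ge> 0"
    unfolding cap using half_line_deriv_funpow_frac_power_series(2)[OF g0 \<open>\<alpha> > 0\<close>, where k = l and c = 0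
        and e = "real l" and t = t and F = "frac_integral (real l - \<alpha>) G"] that g' l h
    by (simp add: frac_power_series_def)
  show "fps_conv_radius (caputo_fps \<alpha> f) = \<infinity>"
    using half_line_deriv_funpow_frac_power_series(1)[OF g0 \<open>\<alpha> > 0\<close>, where k = l and c = 0
        and e = "real l" and t = 0 and F = "frac_integral (real l - \<alpha>) G"] g' l h
    by simp
qed

lemma funpow_caputo_deriv_eval_fps:
  fixes f :: "complex fps"
  assumes "fps_conv_radius f = \<infinity>" "\<alpha> > 0"
    and "\<And>t. t \<ge> 0 \<Longrightarrow> F t = eval_fps f (of_real (t powr \<alpha>))"
  shows "fps_conv_radius ((caputo_fps \<alpha> ^^ j) f) = \<infinity> \<and>
    (\<forall>t\<ge>0. (caputo_deriv \<alpha> ^^ j) F t = eval_fps ((caputo_fps \<alpha> ^^ j) f) (of_real (t powr \<alpha>)))"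
proof (induction j)
  case (Suc j)
  thus ?case
    using caputo_deriv_eval_fps[of "(caputo_fps \<alpha> ^^ j) f" \<alpha> "(caputo_deriv \<alpha> ^^ j) F"] assms by simp
qed (use assms in simp)

lemma fps_nth_caputo_fps:
  "fps_nth (caputo_fps \<alpha> f) m = fps_nth f (Suc m) *
     of_real (Gamma (\<alpha> * real (Suc m) + 1) / Gamma (\<alpha> * real m + 1))"
  by (simp add: caputo_fps_def)

text \<open>The Gamma quotients of successive steps telescope.\<close>

lemma fps_nth_funpow_caputo_fps:
  assumes "\<alpha> > 0"
  shows "fps_nth ((caputo_fps \<alpha> ^^ j) f) m =
    fps_nth f (m + j) * of_real (Gamma (\<alpha> * real (m + j) + 1) / Gamma (\<alpha> * real m + 1))"
proof (induction j arbitrary: m)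
  case 0
  have "Gamma (\<alpha> * real m + 1) > 0"
    using assms by (intro Gamma_real_pos add_nonneg_pos) auto
  thus ?case by simp
next
  case (Suc j)
  have "Gamma (\<alpha> * real (Suc m) + 1) > 0"
    using assms by (intro Gamma_real_pos add_nonneg_pos) auto
  thus ?case by (simp add: fps_nth_caputo_fps Suc.IH del: of_nat_Suc of_nat_add)
qed

section \<open>Growth of the coefficients and of the entire function\<close>

text \<open>Restricting the Gamma integral to \<open>{T..T+1}\<close> allows \<open>t powr s\<close>
  to be replaced by \<open>T powr s\<close>. The freedom to choose \<open>T\<close> later lets this
  elementary bound take the place of Stirling's formula.\<close>

lemma Gamma_ge_powr:
  fixes s T :: real
  assumes "s \<ge> 0" "T > 0"
  shows "T powr s * exp (- T) * (1 - exp (- 1)) \<le> Gamma (s + 1)"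
proof -
  have G: "((\<lambda>t. t powr s / exp t) has_integral Gamma (s + 1)) {0..}"
    using Gamma_integral_real[of "s + 1"] assms by simp
  have "((\<lambda>t. exp (- t)) has_integral (- exp (- (T + 1)) - (- exp (- T)))) {T..T+1}"
    by (rule fundamental_theorem_of_calculus)
       (auto intro!: derivative_eq_intros simp flip: has_real_derivative_iff_has_vector_derivative)
  hence "((\<lambda>t. T powr s * exp (- t)) has_integral T powr s * (- exp (- (T + 1)) - (- exp (- T)))) {T..T+1}"
    by (rule has_integral_mult_right)
  hence 1: "((\<lambda>t. T powr s * exp (- t)) has_integral T powr s * exp (- T) * (1 - exp (- 1))) {T..T+1}"
    by (simp add: right_diff_distrib exp_diff exp_minus field_simps)
  have int: "(\<lambda>t. t powr s / exp t) integrable_on {T..T+1}"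
    using assms by (intro integrable_continuous_real continuous_intros) auto
  have "T powr s * exp (- T) * (1 - exp (- 1)) \<le> integral {T..T+1} (\<lambda>t. t powr s / exp t)"
  proof (rule has_integral_le[OF 1 integrable_integral[OF int]])
    fix t assume "t \<in> {T..T+1}"
    hence "T powr s \<le> t powr s" using assms by (intro powr_mono2) auto
    thus "T powr s * exp (- t) \<le> t powr s / exp t" by (simp add: exp_minus divide_right_mono field_simps)
  qed
  also have "\<dots> \<le> Gamma (s + 1)"
    by (rule has_integral_subset_le[OF _ integrable_integral[OF int] G]) (use assms in auto)
  finally show ?thesis .
qed

text \<open>By log-convexity, moving either endpoint of a chord of \<open>ln (Gamma x)\<close> to
  the right does not decrease its slope; the chord from \<open>a\<close> to \<open>d\<close> is the
  intermediate one.\<close>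

lemma Gamma_slope_mono:
  fixes a b c d :: real
  assumes "0 < a" "a < b" "c < d" "a \<le> c" "b \<le> d"
  shows "(ln (Gamma b) - ln (Gamma a)) / (b - a) \<le> (ln (Gamma d) - ln (Gamma c)) / (d - c)"
proof -
  let ?f = "ln \<circ> Gamma :: real \<Rightarrow> real"
  have sw: "(?f p - ?f q) / (p - q) = (?f q - ?f p) / (q - p)" for p q
    by (metis minus_diff_eq minus_divide_divide)
  have 1: "(?f b - ?f a) / (b - a) \<le> (?f d - ?f a) / (d - a)"
  proof (cases "b = d")
    case False
    thus ?thesis
      using convex_on_slope_le(1)[OF log_convex_Gamma_real, of a d b] assms sw[of b a] sw[of d a]
      by simp
  qed simp
  have 2: "(?f d - ?f a) / (d - a) \<le> (?f d - ?f c) / (d - c)"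
  proof (cases "a = c")
    case False
    thus ?thesis
      using convex_on_slope_le(2)[OF log_convex_Gamma_real, of a d c] assms sw[of d a] sw[of d c]
      by simp
  qed simp
  from 1 2 show ?thesis by simp
qed

text \<open>Strong induction against the weight \<open>h\<close>. The bound at a smaller index,
  times the Gamma ratio, stays below the weight at the new index, so the recurrence coefficients
  cost only a geometric factor.\<close>

lemma recurrence_growth:
  fixes b :: "nat \<Rightarrow> complex" and q :: "nat \<Rightarrow> nat \<Rightarrow> complex" and \<alpha> :: real
  assumes "\<alpha> > 0" "n \<ge> 1"
  defines "g \<equiv> \<lambda>m::nat. Gamma (\<alpha> * real m + 1)"
  assumes rec: "\<And>m. b (m + n) =
     - (\<Sum>j<n. \<Sum>i\<le>min d m. q j i * (b (m - i + j) * of_real (g m / g (m - i))))"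
  shows "\<exists>K A. A > 0 \<and> K \<ge> 0 \<and> (\<forall>m. norm (b m) \<le> K * A ^ m * g m powr (real d / real (d + 1)))"
proof -
  define \<theta> where "\<theta> = real d / real (d + 1)"
  have \<theta>: "\<theta> \<ge> 0" by (simp add: \<theta>_def)
  have gpos: "g m > 0" for m
    unfolding g_def using \<open>\<alpha> > 0\<close> by (intro Gamma_real_pos add_nonneg_pos) auto
  define B where "B = max 1 (1 / g 1)"
  have B: "B \<ge> 1" by (simp add: B_def)
  \<comment> \<open>The factor \<open>B ^ m\<close> makes the log-convex sequence \<open>g\<close> nondecreasing.\<close>
  define L where "L m = ln (g m) + real m * ln B" for m
  \<comment> \<open>The arguments \<open>\<alpha> * m + 1\<close> rescale all chord slopes by the
    same factor, and the linear term in \<open>L\<close> adds \<open>ln B\<close> to each, so the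
    comparison for \<open>ln (Gamma x)\<close> carries over.\<close>
  have slope: "(L b - L a) / (real b - real a) \<le> (L d - L c) / (real d - real c)"
    if "a < b" "c < d" "a \<le> c" "b \<le> d" for a b c d
  proof -
    have "\<alpha> * real a + 1 > 0" using \<open>\<alpha> > 0\<close> by (intro add_nonneg_pos) auto
    hence "(ln (g b) - ln (g a)) / ((\<alpha> * real b + 1) - (\<alpha> * real a + 1)) \<le>
        (ln (g d) - ln (g c)) / ((\<alpha> * real d + 1) - (\<alpha> * real c + 1))"
      unfolding g_def using that \<open>\<alpha> > 0\<close> by (intro Gamma_slope_mono) auto
    moreover have "(\<alpha> * real y + 1) - (\<alpha> * real x + 1) = \<alpha> * (real y - real x)" for x y
      by (simp add: algebra_simps)
    ultimately have "(ln (g b) - ln (g a)) / (real b - real a) / \<alpha> \<le>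
        (ln (g d) - ln (g c)) / (real d - real c) / \<alpha>"
      by (simp add: mult.commute)
    hence "(ln (g b) - ln (g a)) / (real b - real a) \<le> (ln (g d) - ln (g c)) / (real d - real c)"
      using \<open>\<alpha> > 0\<close> by (simp only: divide_le_cancel if_True less_asym simp_thms)
    moreover have "(L y - L x) / (real y - real x) = (ln (g y) - ln (g x)) / (real y - real x) + ln B"
      if "x < y" for x y
      using that by (simp add: L_def field_simps)
    ultimately show ?thesis using that by simp
  qed
  have "L 1 - L 0 \<ge> 0"
  proof -
    have "ln B \<ge> ln (1 / g 1)" using gpos[of 1] by (intro ln_mono) (auto simp: B_def)
    moreover have "g 0 = 1" by (simp add: g_def)
    ultimately show ?thesis using gpos[of 1] by (simp add: L_def ln_div)
  qed
  have L_mono: "L c \<le> L d" if "c < d" for c d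
  proof -
    have "0 \<le> (L d - L c) / (real d - real c)"
      using slope[of 0 1 c d] that \<open>L 1 - L 0 \<ge> 0\<close> by simp
    thus ?thesis using that by (simp add: zero_le_divide_iff)
  qed
  \<comment> \<open>The chord from \<open>m - i\<close> to \<open>m\<close> has both endpoints no
    further right than the one from \<open>m - i + j\<close> to \<open>m + n\<close>, whose width is
    at least \<open>i + 1\<close>. Comparing slopes bounds the first rise by the fraction
    \<open>i / (i + 1) \<le> d / (d + 1)\<close> of the second.\<close>
  have key: "L m - L (m - i) \<le> \<theta> * (L (m + n) - L (m - i + j))"
    if "i \<le> d" "i \<le> m" "j < n" for i j m
  proof (cases "i = 0")
    case True
    thus ?thesis using \<theta> L_mono[of "m + j" "m + n"] that by simp
  next
    case False
    define D where "D = L (m + n) - L (m - i + j)"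
    define s where "s = real (m + n) - real (m - i + j)"
    have s: "s \<ge> real i + 1" using that unfolding s_def by (simp add: of_nat_diff)
    have D: "D \<ge> 0" using L_mono[of "m - i + j" "m + n"] that by (simp add: D_def)
    have "(L m - L (m - i)) / (real m - real (m - i)) \<le> D / s"
      unfolding D_def s_def using that False by (intro slope) auto
    hence "L m - L (m - i) \<le> D / s * real i"
      using that False by (simp add: of_nat_diff divide_le_eq)
    also have "\<dots> = real i / s * D" by simp
    also have "\<dots> \<le> \<theta> * D"
    proof (intro mult_right_mono D)
      have "real i / s \<le> real i / (real i + 1)" using s by (intro divide_left_mono) auto
      also have "\<dots> \<le> \<theta>" using that by (simp add: \<theta>_def field_simps)
      finally show "real i / s \<le> \<theta>" .
    qed
    finally show ?thesis by (simp add: D_def)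
  qed
  define h where "h m = exp (\<theta> * L m)" for m
  have hpos: "h m > 0" for m by (simp add: h_def)
  have ratio: "g m / g (m - i) \<le> h (m + n) / h (m - i + j)" if "i \<le> d" "i \<le> m" "j < n" for i j m
  proof -
    have "g m / g (m - i) = exp (ln (g m) - ln (g (m - i)))"
      using gpos by (simp add: exp_diff)
    also have "\<dots> \<le> exp (L m - L (m - i))"
    proof -
      \<comment> \<open>\<open>B \<ge> 1\<close> makes the linear term of \<open>L\<close>
        nondecreasing, so replacing \<open>ln (g m)\<close> by \<open>L m\<close> only enlarges the
        difference.\<close>
      have "real (m - i) * ln B \<le> real m * ln B" using B by (intro mult_right_mono) auto
      thus ?thesis by (simp add: L_def)
    qed
    also have "\<dots> \<le> exp (\<theta> * L (m + n) - \<theta> * L (m - i + j))"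
      using key[OF that] by (simp add: right_diff_distrib)
    also have "\<dots> = h (m + n) / h (m - i + j)" by (simp add: h_def exp_diff)
    finally show ?thesis .
  qed
  define Q where "Q = (\<Sum>j<n. \<Sum>i\<le>d. norm (q j i))"
  \<comment> \<open>Exceeding \<open>Q\<close> pays for the sum over all \<open>j\<close> and
    \<open>i\<close>; the added 1 makes powers of \<open>A\<close> monotone. The constant
    \<open>K\<close> absorbs the \<open>n\<close> initial values, which the recurrence leaves
    free.\<close>
  define A where "A = 1 + Q"
  define K where "K = (\<Sum>m<n. norm (b m) / h m)"
  have Q: "Q \<ge> 0" unfolding Q_def by (intro sum_nonneg) auto
  have A: "A \<ge> 1" "Q \<le> A" using Q by (auto simp: A_def)
  have K: "K \<ge> 0" unfolding K_def using hpos by (intro sum_nonneg) (auto simp: less_imp_le)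
  have bound: "norm (b m) \<le> K * A ^ m * h m" for m
  proof (induction m rule: less_induct)
    case (less m)
    show ?case
    proof (cases "m < n")
      case True
      have "norm (b m) / h m \<le> K" unfolding K_def
        using True hpos by (intro member_le_sum) (auto simp: less_imp_le)
      also have "\<dots> \<le> K * A ^ m" using K A mult_left_mono[of 1 "A ^ m" K] by simp
      finally show ?thesis using hpos[of m] by (simp add: divide_le_eq)
    next
      case False
      define p where "p = m - n"
      have m: "m = p + n" using False by (simp add: p_def)
      \<comment> \<open>All indices of \<open>b\<close> in the recurrence are at most
        \<open>m - 1\<close>, so one power of \<open>A\<close> is held back to absorb
        \<open>Q\<close>.\<close>
      define C where "C = K * A ^ (m - 1) * h m"
      have C: "C \<ge> 0" unfolding C_def using K A hpos[of m] by simp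
      have "norm (b m) \<le> (\<Sum>j<n. \<Sum>i\<le>min d p. norm (q j i * (b (p - i + j) * of_real (g p / g (p - i)))))"
        unfolding m rec by (simp only: norm_minus_cancel) (intro order_trans[OF norm_sum] sum_mono norm_sum)
      also have "\<dots> \<le> (\<Sum>j<n. \<Sum>i\<le>min d p. norm (q j i) * C)"
      proof (intro sum_mono)
        fix j i assume ji: "j \<in> {..<n}" "i \<in> {..min d p}"
        hence lt: "p - i + j < m" by (auto simp: m)
        have "norm (b (p - i + j)) * (g p / g (p - i)) \<le>
            (K * A ^ (p - i + j) * h (p - i + j)) * (h (p + n) / h (p - i + j))"
          using ji gpos hpos K A
          by (intro mult_mono less.IH[OF lt] ratio) (auto simp: less_imp_le)
        also have "\<dots> = K * A ^ (p - i + j) * h m"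
          using hpos[of "p - i + j"] by (simp add: m)
        also have "\<dots> \<le> C" unfolding C_def
          using lt K A hpos[of m]
          by (intro mult_right_mono mult_left_mono power_increasing) auto
        finally have "norm (q j i) * (norm (b (p - i + j)) * (g p / g (p - i))) \<le> norm (q j i) * C"
          by (rule mult_left_mono) simp
        thus "norm (q j i * (b (p - i + j) * of_real (g p / g (p - i)))) \<le> norm (q j i) * C"
          using gpos[of p] gpos[of "p - i"] by (simp add: norm_mult norm_divide)
      qed
      also have "\<dots> \<le> (\<Sum>j<n. \<Sum>i\<le>d. norm (q j i) * C)"
        by (intro sum_mono sum_mono2) (auto simp: C)
      also have "\<dots> = Q * C" by (simp add: Q_def sum_distrib_right)
      also have "\<dots> \<le> A * C" using A C by (intro mult_right_mono) auto
      also have "\<dots> = K * A ^ m * h m"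
        using \<open>n \<ge> 1\<close> by (cases m) (auto simp: C_def m)
      finally show ?thesis .
    qed
  qed
  have "h m = exp (\<theta> * ln B) ^ m * g m powr \<theta>" for m
    using gpos[of m] by (simp add: h_def L_def powr_def distrib_left exp_add exp_of_nat_mult[symmetric] mult_ac)
  hence "norm (b m) \<le> K * (A * exp (\<theta> * ln B)) ^ m * g m powr \<theta>" for m
    using bound[of m] by (simp add: power_mult_distrib mult_ac)
  moreover have "A * exp (\<theta> * ln B) > 0" using A by simp
  ultimately show ?thesis using K unfolding \<theta>_def by blast
qed

text \<open>The lower bound for Gamma turns the terms at \<open>z\<close> into a geometric series
  times \<open>exp (\<delta> * T)\<close>. With \<open>T\<close> proportional to
  \<open>norm z powr (1 / (\<alpha> * \<delta>))\<close>, that factor is the asserted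
  growth.\<close>

lemma eval_fps_exp_powr_bound:
  fixes f :: "complex fps"
  assumes f: "fps_conv_radius f = \<infinity>" and "\<alpha> > 0" "\<delta> > 0" "A > 0" "K \<ge> 0"
    and bound: "\<And>m. norm (fps_nth f m) \<le> K * A ^ m * Gamma (\<alpha> * real m + 1) powr (- \<delta>)"
  shows "\<exists>C D. C > 0 \<and> D > 0 \<and> (\<forall>z. z \<noteq> 0 \<longrightarrow>
           norm (eval_fps f z) \<le> C * exp (D * norm z powr (1 / (\<alpha> * \<delta>))))"
proof -
  define c where "c = 1 - exp (- 1 :: real)"
  have c: "c > 0" by (simp add: c_def)
  define \<rho> where "\<rho> = 1 / (\<alpha> * \<delta>)"
  define D where "D = \<delta> * (2 * A) powr \<rho>"
  define C where "C = K * c powr (- \<delta>)"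
  have C: "C \<ge> 0" using assms by (simp add: C_def)
  \<comment> \<open>The summand 1 keeps the constant positive when \<open>C = 0\<close>.\<close>
  have "norm (eval_fps f z) \<le> (2 * C + 1) * exp (D * norm z powr \<rho>)" if "z \<noteq> 0" for z
  proof -
    define r where "r = norm z"
    have r: "r > 0" using that by (simp add: r_def)
    \<comment> \<open>This choice of the free parameter of Gamma_ge_powr leaves a geometric series of ratio \<open>1 / 2\<close>.\<close>
    define T where "T = (2 * A * r) powr \<rho>"
    have T: "T > 0" using r \<open>A > 0\<close> by (simp add: T_def)
    define E where "E = C * exp (\<delta> * T)"
    have summand: "norm (fps_nth f m * z ^ m) \<le> E * (1 / 2) ^ m" for m
    proof -
      let ?s = "\<alpha> * real m"
      have "0 < T powr ?s * exp (- T) * c" using T c by simp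
      hence "Gamma (?s + 1) powr (- \<delta>) \<le> (T powr ?s * exp (- T) * c) powr (- \<delta>)"
        using Gamma_ge_powr[of ?s T] T assms by (intro powr_mono2') (auto simp: c_def)
      also have "\<dots> = T powr (- (\<alpha> * \<delta> * real m)) * exp (\<delta> * T) * c powr (- \<delta>)"
        using T c by (simp add: powr_mult powr_powr exp_powr_real mult_ac)
      \<comment> \<open>Since \<open>\<rho> * \<alpha> * \<delta> = 1\<close>, the real power
        becomes \<open>(2 * A * r) ^ m\<close> in the denominator, which cancels
        \<open>A ^ m * r ^ m\<close> and leaves \<open>(1 / 2) ^ m\<close>.\<close>
      also have "T powr (- (\<alpha> * \<delta> * real m)) = 1 / (2 * A * r) ^ m"
        using r assms by (simp add: T_def \<rho>_def powr_powr powr_minus_divide powr_realpow)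
      finally have "Gamma (?s + 1) powr (- \<delta>) \<le> 1 / (2 * A * r) ^ m * exp (\<delta> * T) * c powr (- \<delta>)" .
      hence "K * A ^ m * Gamma (?s + 1) powr (- \<delta>) * r ^ m
          \<le> K * A ^ m * (1 / (2 * A * r) ^ m * exp (\<delta> * T) * c powr (- \<delta>)) * r ^ m"
        using assms r by (intro mult_right_mono mult_left_mono) auto
      also have "\<dots> = E * (1 / 2) ^ m"
        using r assms by (simp add: E_def C_def power_mult_distrib field_simps)
      finally have "K * A ^ m * Gamma (?s + 1) powr (- \<delta>) * r ^ m \<le> E * (1 / 2) ^ m" .
      moreover have "norm (fps_nth f m * z ^ m) \<le> K * A ^ m * Gamma (?s + 1) powr (- \<delta>) * r ^ m"
        using bound[of m] r by (simp add: norm_mult norm_power r_def mult_right_mono)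
      ultimately show ?thesis by linarith
    qed
    have geo: "(\<lambda>m. E * (1 / 2) ^ m) sums (E * 2)"
      using sums_mult[OF geometric_sums[of "1 / 2 :: real"], of E] by simp
    have "norm (eval_fps f z) \<le> (\<Sum>m. E * (1 / 2) ^ m)"
      unfolding eval_fps_def using summand geo
      by (intro norm_suminf_le) (auto simp: sums_iff)
    also have "\<dots> = 2 * C * exp (\<delta> * T)" using geo by (simp add: sums_iff E_def)
    also have "\<delta> * T = D * r powr \<rho>"
      using r assms by (simp add: T_def D_def powr_mult)
    finally show ?thesis by (simp add: r_def distrib_right add_increasing2)
  qed
  moreover have "D > 0" using assms by (simp add: D_def)
  moreover have "2 * C + 1 > 0" using C by simp
  ultimately show ?thesis unfolding \<rho>_def by blast
qed

text \<open>Finiteness also requires excluding \<open>- \<infinity>\<close>. For a nonconstant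
  function some coefficient of index \<open>k \<ge> 1\<close> is nonzero, and Cauchy's inequality
  makes the maximum modulus grow at least linearly, so the iterated logarithm is eventually
  nonnegative. The exponential bound gives the other side, \<open>\<rho> + 1\<close>.\<close>

lemma growth_order_finite:
  fixes f :: "complex fps"
  assumes f: "fps_conv_radius f = \<infinity>" and "C > 0" "D > 0" "\<rho> > 0"
    and bound: "\<And>z. z \<noteq> 0 \<Longrightarrow> norm (eval_fps f z) \<le> C * exp (D * norm z powr \<rho>)"
  shows "\<bar>growth_order (eval_fps f)\<bar> \<noteq> \<infinity>"
proof (cases "eval_fps f constant_on UNIV")
  case True
  thus ?thesis by (simp add: growth_order_def)
next
  case nonconst: False
  define M where "M r = max_modulus r (eval_fps f)" for r
  have hol: "eval_fps f holomorphic_on S" for S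
    using f by (intro holomorphic_on_eval_fps) auto
  have cont: "continuous_on S (eval_fps f)" for S
    using hol by (rule holomorphic_on_imp_continuous_on)
  have le_M: "norm (eval_fps f z) \<le> M (norm z)" for z
    unfolding M_def max_modulus_def
    by (rule cSUP_upper)
       (auto intro!: bounded_imp_bdd_above compact_imp_bounded compact_continuous_image
          continuous_on_norm cont)
  have M_le: "M r \<le> C * exp (D * r powr \<rho>)" if "r > 0" for r
    unfolding M_def max_modulus_def
  proof (rule cSUP_least)
    show "sphere (0 :: complex) r \<noteq> {}" using that by simp
    show "norm (eval_fps f z) \<le> C * exp (D * r powr \<rho>)" if "z \<in> sphere 0 r" for z
      using bound[of z] that \<open>r > 0\<close> by auto
  qed
  have "\<exists>k\<ge>1. fps_nth f k \<noteq> 0"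
  proof (rule ccontr)
    assume "\<not> (\<exists>k\<ge>1. fps_nth f k \<noteq> 0)"
    hence "fps_nth f k = 0" if "k \<ge> 1" for k using that by blast
    hence "f = fps_const (fps_nth f 0)" by (intro fps_ext) (auto simp: not_less_eq_eq)
    hence "eval_fps f z = fps_nth f 0" for z by (metis eval_fps_const)
    thus False using nonconst by (auto simp: constant_on_def)
  qed
  then obtain k where k: "k \<ge> 1" "fps_nth f k \<noteq> 0" by blast
  have M_ge: "norm (fps_nth f k) * r ^ k \<le> M r" if "r > 0" for r
  proof -
    have "norm ((deriv ^^ k) (eval_fps f) 0) \<le> fact k * M r / r ^ k"
      using that le_M by (intro Cauchy_inequality hol cont) auto
    moreover have "norm (fps_nth f k) = norm ((deriv ^^ k) (eval_fps f) 0) / fact k"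
      using f by (subst fps_nth_conv_deriv) (auto simp: norm_divide)
    ultimately have "norm (fps_nth f k) \<le> fact k * M r / r ^ k / fact k"
      by (simp only: divide_right_mono fact_ge_zero)
    thus ?thesis using that by (simp add: field_simps)
  qed
  define a where "a = norm (fps_nth f k)"
  have a: "a > 0" using k by (simp add: a_def)
  \<comment> \<open>The 2 makes \<open>ln r\<close> positive, \<open>exp 1 / a\<close> forces
    \<open>M r \<ge> exp 1\<close>, and the last entry lets a factor \<open>r\<close> absorb
    \<open>D\<close> and \<open>ln C\<close>, which is why the bound is \<open>\<rho> + 1\<close>
    rather than \<open>\<rho>\<close>.\<close>
  define R where "R = Max {2, exp 1 / a, D + \<bar>ln C\<bar>}"
  have ev: "0 \<le> ln (ln (M r)) / ln r \<and> ln (ln (M r)) / ln r \<le> \<rho> + 1" if "r \<ge> R" for r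
  proof -
    have r: "r \<ge> 2" "r \<ge> exp 1 / a" "r \<ge> D + \<bar>ln C\<bar>" using that by (auto simp: R_def)
    have "exp 1 \<le> a * r" using r a by (simp add: field_simps)
    also have "\<dots> \<le> a * r ^ k" using r a k by (intro mult_left_mono self_le_power) auto
    also have "\<dots> \<le> M r" using M_ge[of r] r by (simp add: a_def)
    finally have M1: "exp 1 \<le> M r" .
    have M0: "M r > 0" using M1 by (rule less_le_trans[rotated]) simp
    have l1: "ln (M r) \<ge> 1" using M1 M0 by (simp add: ln_ge_iff)
    have "ln (M r) \<le> ln (C * exp (D * r powr \<rho>))"
      using M_le[of r] M0 r by (intro ln_mono) auto
    also have "\<dots> = ln C + D * r powr \<rho>" using \<open>C > 0\<close> by (simp add: ln_mult)
    also have "\<dots> \<le> \<bar>ln C\<bar> * r powr \<rho> + D * r powr \<rho>"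
    proof -
      have "1 \<le> r powr \<rho>" using r \<open>\<rho> > 0\<close> by (intro ge_one_powr_ge_zero) auto
      hence "\<bar>ln C\<bar> * 1 \<le> \<bar>ln C\<bar> * r powr \<rho>" by (intro mult_left_mono) auto
      thus ?thesis by linarith
    qed
    also have "\<dots> = (D + \<bar>ln C\<bar>) * r powr \<rho>" by (simp add: algebra_simps)
    also have "\<dots> \<le> r * r powr \<rho>" using r by (intro mult_right_mono) auto
    also have "\<dots> = r powr (\<rho> + 1)" using r by (simp add: powr_add mult.commute)
    finally have "ln (ln (M r)) \<le> ln (r powr (\<rho> + 1))" using l1 by (intro ln_mono) auto
    also have "\<dots> = (\<rho> + 1) * ln r" using r by (simp add: ln_powr)
    finally have "ln (ln (M r)) \<le> (\<rho> + 1) * ln r" .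
    thus ?thesis using l1 r by (simp add: divide_le_eq)
  qed
  have "Limsup at_top (\<lambda>r. ereal (ln (ln (M r)) / ln r)) \<le> ereal (\<rho> + 1)"
    using ev by (intro Limsup_bounded eventually_at_top_linorderI[of R]) auto
  moreover have "0 \<le> Limsup at_top (\<lambda>r. ereal (ln (ln (M r)) / ln r))"
    using ev by (intro le_Limsup eventually_at_top_linorderI[of R]) auto
  ultimately show ?thesis using nonconst
    by (auto simp: growth_order_def M_def[symmetric])
qed

section \<open>Identity theorem and passage from the equation to the coefficient recurrence\<close>

lemma fps_eq_0_if_eval_fps_eq_0_on_half_line:
  fixes f :: "complex fps"
  assumes f: "fps_conv_radius f = \<infinity>" and "\<And>x::real. x \<ge> 0 \<Longrightarrow> eval_fps f (of_real x) = 0"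
  shows "f = 0"
proof -
  \<comment> \<open>The segment supplies zeros accumulating at 1, so analytic continuation over the
    plane forces the function to vanish.\<close>
  have lim: "(1 :: complex) islimpt of_real ` {0..1}"
  proof -
    have "(1 :: real) islimpt {0..1}" by (simp add: islimpt_Icc)
    hence "of_real (1 :: real) islimpt (of_real ` {0..1} :: complex set)"
      by (intro islimpt_isCont_image) (auto simp: eventually_at_filter)
    thus ?thesis by simp
  qed
  have hol: "eval_fps f holomorphic_on UNIV"
    using f by (intro holomorphic_on_eval_fps) simp
  have zero: "eval_fps f w = 0" if "w \<in> of_real ` {0..1}" for w
    using that assms(2) by auto
  have "eval_fps f z = 0" for z
    by (rule analytic_continuation[OF hol open_UNIV connected_UNIV subset_UNIV UNIV_I lim zero UNIV_I])
  hence "eval_fps f = (\<lambda>_. 0)" by auto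
  hence "fps_nth f m = 0" for m
    using f by (simp add: fps_nth_conv_deriv)
  thus ?thesis by (intro fps_ext) simp
qed

theorem theorem3:
  fixes \<alpha> :: real and n :: nat
    and p :: "nat \<Rightarrow> real \<Rightarrow> complex" and P :: "nat \<Rightarrow> complex poly"
    and y :: "real \<Rightarrow> complex"
  assumes "\<alpha> > 0" and "n \<ge> 1"
    and "\<And>j x. j < n \<Longrightarrow> x \<ge> 0 \<Longrightarrow> p j x = poly (P j) (of_real (x powr \<alpha>))"
    and "alpha_analytic \<alpha> y"
    and "\<And>x. x \<ge> 0 \<Longrightarrow>
           (caputo_deriv \<alpha> ^^ n) y x + (\<Sum>j<n. p j x * (caputo_deriv \<alpha> ^^ j) y x) = 0"
  shows "\<exists>v. v holomorphic_on UNIV \<and> \<bar>growth_order v\<bar> \<noteq> \<infinity> \<and>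
           (\<forall>t\<ge>0. y t = v (of_real (t powr \<alpha>)))"
proof -
  have onto: "x = (x powr (1 / \<alpha>)) powr \<alpha>" if "x \<ge> 0" for x :: real
    using that \<open>\<alpha> > 0\<close> by (simp add: powr_powr)
  from \<open>alpha_analytic \<alpha> y\<close> obtain c where
    c: "\<And>t. t \<ge> 0 \<Longrightarrow> (\<lambda>m. c m * of_real ((t powr \<alpha>) ^ m)) sums y t"
    unfolding alpha_analytic_def by blast
  define f where "f = Abs_fps c"
  have f: "fps_conv_radius f = \<infinity>"
  proof (rule fps_conv_radius_infinityI)
    fix x :: real assume "x > 0"
    thus "summable (\<lambda>m. fps_nth f m * of_real x ^ m)"
      using c[of "x powr (1 / \<alpha>)"] onto[of x] by (simp add: f_def sums_iff)
  qed
  have y: "y t = eval_fps f (of_real (t powr \<alpha>))" if "t \<ge> 0" for t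
    using c[OF that] by (simp add: eval_fps_def f_def sums_iff)
  define Df where "Df j = (caputo_fps \<alpha> ^^ j) f" for j
  have Df: "fps_conv_radius (Df j) = \<infinity>"
    and Df': "t \<ge> 0 \<Longrightarrow> (caputo_deriv \<alpha> ^^ j) y t = eval_fps (Df j) (of_real (t powr \<alpha>))" for j t
    using funpow_caputo_deriv_eval_fps[OF f \<open>\<alpha> > 0\<close> y] unfolding Df_def by auto
  have sum: "fps_conv_radius (\<Sum>j<k. fps_of_poly (P j) * Df j) = \<infinity> \<and>
      eval_fps (\<Sum>j<k. fps_of_poly (P j) * Df j) z = (\<Sum>j<k. poly (P j) z * eval_fps (Df j) z)" for k z
    by (induction k) (simp_all add: fps_conv_radius_infinity_add fps_conv_radius_infinity_mult
        eval_fps_add eval_fps_mult Df)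
  define E where "E = Df n + (\<Sum>j<n. fps_of_poly (P j) * Df j)"
  \<comment> \<open>The equation only makes \<open>E\<close> vanish on the half-line; the identity
    theorem turns this into the vanishing of all coefficients.\<close>
  have "E = 0"
  proof (rule fps_eq_0_if_eval_fps_eq_0_on_half_line)
    show "fps_conv_radius E = \<infinity>"
      unfolding E_def using sum Df by (intro fps_conv_radius_infinity_add) auto
    fix x :: real assume "x \<ge> 0"
    define t where "t = x powr (1 / \<alpha>)"
    have x: "x = t powr \<alpha>" and t: "t \<ge> 0" using onto[OF \<open>x \<ge> 0\<close>] by (auto simp: t_def)
    have "eval_fps E (of_real x) = eval_fps (Df n) (of_real x) + (\<Sum>j<n. poly (P j) (of_real x) * eval_fps (Df j) (of_real x))"
      unfolding E_def using sum Df by (subst eval_fps_add) auto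
    also have "\<dots> = (caputo_deriv \<alpha> ^^ n) y t + (\<Sum>j<n. p j t * (caputo_deriv \<alpha> ^^ j) y t)"
      using t by (simp add: x Df' assms(3))
    also have "\<dots> = 0" using t by (rule assms(5))
    finally show "eval_fps E (of_real x) = 0" .
  qed
  define g where "g m = Gamma (\<alpha> * real m + 1)" for m
  have gpos: "g m > 0" for m
    unfolding g_def using \<open>\<alpha> > 0\<close> by (intro Gamma_real_pos add_nonneg_pos) auto
  \<comment> \<open>Weighting by \<open>g\<close> makes the coefficients of every iterate a shift of
    the same sequence \<open>b\<close>, divided by \<open>g m\<close> independently of
    \<open>j\<close>.\<close>
  define b where "b m = fps_nth f m * of_real (g m)" for m
  have Dfn: "fps_nth (Df j) m = b (m + j) / of_real (g m)" for j m
    unfolding Df_def fps_nth_funpow_caputo_fps[OF \<open>\<alpha> > 0\<close>] b_def g_def by simp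
  define d where "d = (\<Sum>j<n. degree (P j))"
  have d: "coeff (P j) i = 0" if "j < n" "i > d" for i j
  proof (rule coeff_eq_0)
    have "degree (P j) \<le> d" unfolding d_def using that by (intro member_le_sum) auto
    thus "degree (P j) < i" using that by simp
  qed
  \<comment> \<open>Coefficient \<open>m\<close> of \<open>E = 0\<close>, multiplied by
    \<open>g m\<close>. The index \<open>i\<close> stops at \<open>min d m\<close>: beyond
    \<open>d\<close> the polynomial coefficients vanish, and \<open>i \<le> m\<close> keeps the
    natural subtraction exact.\<close>
  have rec: "b (m + n) = - (\<Sum>j<n. \<Sum>i\<le>min d m. coeff (P j) i *
      (b (m - i + j) * of_real (g m / g (m - i))))" for m
  proof -
    have prod: "fps_nth (fps_of_poly (P j) * Df j) m * of_real (g m) =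
        (\<Sum>i\<le>min d m. coeff (P j) i * (b (m - i + j) * of_real (g m / g (m - i))))" if "j < n" for j
    proof -
      have "fps_nth (fps_of_poly (P j) * Df j) m = (\<Sum>i\<le>m. coeff (P j) i * fps_nth (Df j) (m - i))"
        by (simp add: fps_mult_nth atLeast0AtMost)
      also have "\<dots> = (\<Sum>i\<le>min d m. coeff (P j) i * fps_nth (Df j) (m - i))"
        using d that by (intro sum.mono_neutral_right) auto
      finally have eq: "fps_nth (fps_of_poly (P j) * Df j) m = \<dots>" .
      show ?thesis unfolding eq sum_distrib_right by (intro sum.cong refl) (simp add: Dfn)
    qed
    have "(\<Sum>j<n. \<Sum>i\<le>min d m. coeff (P j) i * (b (m - i + j) * of_real (g m / g (m - i))))
        = fps_nth (\<Sum>j<n. fps_of_poly (P j) * Df j) m * of_real (g m)"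
      unfolding fps_sum_nth sum_distrib_right
      by (rule sum.cong[OF refl], rule prod[symmetric]) simp
    moreover have "b (m + n) = fps_nth (Df n) m * of_real (g m)"
      using gpos[of m] by (simp add: Dfn)
    moreover have "fps_nth (Df n) m = - fps_nth (\<Sum>j<n. fps_of_poly (P j) * Df j) m"
      using arg_cong[OF \<open>E = 0\<close>, of "\<lambda>h. fps_nth h m"] unfolding E_def
      by (simp only: fps_add_nth fps_zero_nth eq_neg_iff_add_eq_0)
    ultimately show ?thesis by (simp only: mult_minus_left)
  qed
  obtain K A where KA: "A > 0" "K \<ge> 0"
    "\<And>m. norm (b m) \<le> K * A ^ m * g m powr (real d / real (d + 1))"
    using recurrence_growth[OF \<open>\<alpha> > 0\<close> \<open>n \<ge> 1\<close>, where b = b and d = d and q = "\<lambda>j. coeff (P j)"]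
      rec unfolding g_def by blast
  define \<delta> where "\<delta> = 1 / real (d + 1)"
  have "\<delta> > 0" by (simp add: \<delta>_def)
  have "norm (fps_nth f m) \<le> K * A ^ m * Gamma (\<alpha> * real m + 1) powr (- \<delta>)" for m
  proof -
    \<comment> \<open>Dividing \<open>b\<close> by \<open>g\<close> lowers the exponent
      \<open>d / (d + 1)\<close> by 1 to \<open>- \<delta>\<close>, the decay that makes the order
      finite.\<close>
    have "real d / real (d + 1) - 1 = - \<delta>" by (simp add: \<delta>_def field_simps)
    hence "g m powr (- \<delta>) = g m powr (real d / real (d + 1)) / g m"
      using gpos[of m] powr_diff[of "g m" "real d / real (d + 1)" 1] by simp
    moreover have "norm (fps_nth f m) = norm (b m) / g m"
      using gpos[of m] by (simp add: b_def norm_mult)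
    ultimately show ?thesis
      using KA(3)[of m] gpos[of m] by (simp add: g_def[symmetric] divide_right_mono)
  qed
  from eval_fps_exp_powr_bound[OF f \<open>\<alpha> > 0\<close> \<open>\<delta> > 0\<close> KA(1,2) this]
  obtain C D where CD: "C > 0" "D > 0"
    "\<And>z. z \<noteq> 0 \<Longrightarrow> norm (eval_fps f z) \<le> C * exp (D * norm z powr (1 / (\<alpha> * \<delta>)))" by blast
  have "\<bar>growth_order (eval_fps f)\<bar> \<noteq> \<infinity>"
    using \<open>\<alpha> > 0\<close> \<open>\<delta> > 0\<close> by (intro growth_order_finite[OF f CD(1,2) _ CD(3)]) auto
  moreover have "eval_fps f holomorphic_on UNIV"
    using f by (intro holomorphic_on_eval_fps) auto
  ultimately show ?thesis using y by (intro exI[of _ "eval_fps f"]) simp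
qed

end
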